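(* There is an infinite overlap-free word $\mathbf{w}$ over the alphabet $\{0,1,2,3\}$ whose curling-number transform $C(\mathbf{w})$ is overlap-free.
   Context: Words are indexed from $0$; infinite words are one-sided, $\mathbf{w} = \mathbf{w}[0]\mathbf{w}[1]\cdots$; $x[i..j]$ denotes the factor (contiguous block) $x[i]\cdots x[j]$. An overlap is a word of the form $a x a x a$ with $a$ a single letter and $x$ a possibly empty word; a word is overlap-free if it contains no overlap as a factor. The curling number of a nonempty finite word $u$ is the largest integer $k \ge 1$ such that $u = y z^k$ for some (possibly empty) word $y$ and some nonempty word $z$. For a finite or infinite word $x$, the curling-number transform $C(x)$ is the word over the positive integers, of the same length as $x$, whose $i$-th letter $C(x)[i]$ is the curling number of the prefix $x[0..i]$. *)

theory Defs
  imports Main "HOL-Library.Omega_Words_Fun"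
begin

definition overlap :: "'a list \<Rightarrow> bool" where
  "overlap u \<longleftrightarrow> (\<exists>a x. u = [a] @ x @ [a] @ x @ [a])"

text \<open>The factor \<open>w [i \<rightarrow> j]\<close> is half-open: it consists of the letters at
  positions \<open>i, \<dots>, j - 1\<close>.\<close>

definition overlap_free :: "'a word \<Rightarrow> bool" where
  "overlap_free w \<longleftrightarrow> \<not> (\<exists>i j. overlap (w [i \<rightarrow> j]))"

text \<open>The word \<open>z\<^sup>k\<close> is \<open>concat (replicate k z)\<close>. The value at the empty word is
  unspecified.\<close>

definition curling_number :: "'a list \<Rightarrow> nat" where
  "curling_number u =
     (GREATEST k. 1 \<le> k \<and> (\<exists>y z. z \<noteq> [] \<and> u = y @ concat (replicate k z)))"

text \<open>The prefix ending at position \<open>i\<close> inclusive has length \<open>Suc i\<close>, so it is never empty.\<close>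

definition curling_transform :: "'a word \<Rightarrow> nat word" where
  "curling_transform w = (\<lambda>i. curling_number (w [0 \<rightarrow> Suc i]))"

lemma curling_number_bound:
  assumes "z \<noteq> []" "u = y @ concat (replicate k z)"
  shows "k \<le> length u"
proof -
  have "length (concat (replicate k z)) = k * length z"
    by (induction k) auto
  with assms show ?thesis
    by (cases z) auto
qed

text \<open>On nonempty words the maximum in the definition of the curling number is attained.\<close>

lemma curling_number_attained:
  assumes "u \<noteq> []"
  shows "1 \<le> curling_number u \<and>
    (\<exists>y z. z \<noteq> [] \<and> u = y @ concat (replicate (curling_number u) z))"
  unfolding curling_number_def
proof (rule GreatestI_nat[where k = 1 and b = "length u"])
  show "1 \<le> (1::nat) \<and> (\<exists>y z. z \<noteq> [] \<and> u = y @ concat (replicate 1 z))"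
    using assms by (intro conjI exI[of _ "[]"] exI[of _ u]) auto
qed (blast intro: curling_number_bound)

lemma curling_number_greatest:
  assumes "1 \<le> k" "z \<noteq> []" "u = y @ concat (replicate k z)"
  shows "k \<le> curling_number u"
  unfolding curling_number_def
proof (rule Greatest_le_nat[where b = "length u"])
  show "1 \<le> k \<and> (\<exists>y z. z \<noteq> [] \<and> u = y @ concat (replicate k z))"
    using assms by blast
qed (blast intro: curling_number_bound)

end

theory Submission
  imports Defs
begin

text \<open>Let \<open>t\<close> be the Thue--Morse word. The word \<open>w\<close> is a suffix of the image of \<open>t\<close> under a code
  that replaces each position of \<open>t\<close> by a block of length 8 depending on the four letters of \<open>t\<close>
  that start there. The blocks come from a SAT search; they make a square end at a position of \<open>w\<close>
  exactly when the letter of \<open>t\<close> at a fixed distance from that position is 1, so the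
  curling-number transform of \<open>w\<close> is a suffix of \<open>t\<close> up to renaming letters. Periods below 16 are
  settled by a finite check over the factors of length 8 of \<open>t\<close>. A square of period at least 16
  contains a whole block in its first half; the blocks synchronise, so its period is a multiple
  \<open>8m\<close> of the block length. Because the code looks ahead three letters, decoding only the whole
  blocks in the first half already yields an overlap of period \<open>m\<close> in \<open>t\<close>, which is impossible.\<close>

section \<open>Squares and overlaps in infinite words\<close>

definition square_at :: "'a word \<Rightarrow> nat \<Rightarrow> nat \<Rightarrow> bool" where
  "square_at w i p \<longleftrightarrow> (\<forall>j<p. w (i + j) = w (i + p + j))"

definition overlap_at :: "'a word \<Rightarrow> nat \<Rightarrow> nat \<Rightarrow> bool" where
  "overlap_at w i p \<longleftrightarrow> (\<forall>j\<le>p. w (i + j) = w (i + p + j))"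

lemma overlap_at_imp_square_at: "overlap_at w i p \<Longrightarrow> square_at w i p"
  by (auto simp: overlap_at_def square_at_def)

lemma overlap_freeI:
  assumes "\<And>i p. 0 < p \<Longrightarrow> \<not> overlap_at w i p"
  shows "overlap_free w"
  unfolding overlap_free_def
proof (intro notI, elim exE)
  fix i j assume "overlap (w [i \<rightarrow> j])"
  then obtain a x where u: "w [i \<rightarrow> j] = [a] @ x @ [a] @ x @ [a]"
    unfolding overlap_def by blast
  \<comment> \<open>With \<open>y\<close> the overlap reads \<open>y @ y\<close> followed by the
    first letter of \<open>y\<close>, so its period is \<open>length y\<close>.\<close>
  define y where "y = [a] @ x"
  define p where "p = length y"
  have u: "w [i \<rightarrow> j] = y @ y @ [y ! 0]"
    using u by (simp add: y_def)
  have p: "0 < p"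
    by (simp add: p_def y_def)
  have len: "j - i = 2 * p + 1"
    using arg_cong[OF u, of length] by (simp add: p_def)
  have nth: "w (i + k) = (y @ y @ [y ! 0]) ! k" if "k < 2 * p + 1" for k
    using subsequence_nth[of k j i w] that len u by simp
  have "w (i + k) = w (i + p + k)" if "k \<le> p" for k
    using that nth[of k] nth[of "p + k"] p
    by (cases "k = p") (auto simp: p_def nth_append add.assoc)
  then have "overlap_at w i p"
    by (simp add: overlap_at_def)
  with assms[of p i] p show False
    by simp
qed

lemma overlap_freeD:
  assumes "overlap_free w" "0 < p"
  shows "\<not> overlap_at w i p"
proof
  assume ov: "overlap_at w i p"
  define x where "x = w [Suc i \<rightarrow> i + p]"
  have "w [i \<rightarrow> i + 2 * p + 1] = [w i] @ x @ [w i] @ x @ [w i]"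
  proof (rule nth_equalityI)
    show "length (w [i \<rightarrow> i + 2 * p + 1]) = length ([w i] @ x @ [w i] @ x @ [w i])"
      using assms(2) by (simp add: x_def)
    fix k assume "k < length (w [i \<rightarrow> i + 2 * p + 1])"
    then have k: "k < 2 * p + 1" by simp
    have per: "w (i + p + j) = w (i + j)" if "j \<le> p" for j
      using ov that by (simp add: overlap_at_def)
    have x: "[w i] @ x = w [i \<rightarrow> i + p]"
      unfolding x_def using assms(2) by (simp add: subsequence_def upt_conv_Cons)
    have eq: "[w i] @ x @ [w i] @ x @ [w i] = w [i \<rightarrow> i + p] @ w [i \<rightarrow> i + p] @ [w i]"
      unfolding x[symmetric] by simp
    have "(w [i \<rightarrow> i + p] @ w [i \<rightarrow> i + p] @ [w i]) ! k = w (i + k)"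
    proof -
      consider "k < p" | "p \<le> k" "k < 2 * p" | "k = 2 * p"
        using k by linarith
      then show ?thesis
      proof cases
        case 2
        then obtain j where "k = p + j" "j < p"
          by (metis add_less_cancel_left le_iff_add mult_2)
        then show ?thesis
          using per[of j] by (simp add: nth_append add.assoc)
      next
        case 3
        then show ?thesis
          using per[of p] per[of 0] by (simp add: nth_append add.assoc mult_2)
      qed (simp add: nth_append)
    qed
    moreover have "(w [i \<rightarrow> i + 2 * p + 1]) ! k = w (i + k)"
      using k by (intro subsequence_nth) simp
    ultimately show "(w [i \<rightarrow> i + 2 * p + 1]) ! k = ([w i] @ x @ [w i] @ x @ [w i]) ! k"
      by (simp only: eq)
  qed
  then show False
    using assms(1) unfolding overlap_free_def overlap_def by blast
qed

text \<open>This carries overlap-freeness from \<open>thue_morse\<close> to the transform, which is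
  a suffix of it with renamed letters.\<close>

lemma overlap_free_inj_comp:
  assumes "overlap_free w" "inj f"
  shows "overlap_free (\<lambda>n. f (w (n + s)))"
proof (rule overlap_freeI)
  fix i p :: nat assume "0 < p"
  with overlap_freeD[OF assms(1), of p "i + s"] assms(2)
  show "\<not> overlap_at (\<lambda>n. f (w (n + s))) i p"
    by (auto simp: overlap_at_def inj_eq ac_simps)
qed

lemma prefix_eq_append_powerE:
  assumes "w [0 \<rightarrow> n] = y @ z @ z @ v"
  shows "square_at w (length y) (length z)"
  unfolding square_at_def
proof (intro allI impI)
  fix j assume j: "j < length z"
  have len: "n = length y + length z + length z + length v"
    using arg_cong[OF assms, of length] by simp
  have "w k = (y @ z @ z @ v) ! k" if "k < n" for k
    using subsequence_nth[of k n 0 w] that assms by simp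
  from this[of "length y + j"] this[of "length y + length z + j"] j len
  show "w (length y + j) = w (length y + length z + j)"
    by (simp add: nth_append)
qed

text \<open>Curling number 3 or more gives a cube \<open>z @ z @ z\<close> in a prefix. Its first
  two copies and the first letter of the third form an overlap.\<close>

lemma curling_number_le_2:
  assumes "overlap_free w"
  shows "curling_transform w n \<le> 2"
proof (rule ccontr)
  let ?u = "w [0 \<rightarrow> Suc n]"
  assume "\<not> ?thesis"
  then have "3 \<le> curling_number ?u"
    by (simp add: curling_transform_def)
  then obtain k where k: "curling_number ?u = Suc (Suc (Suc k))"
    by (auto simp: numeral_3_eq_3 dest: le_Suc_ex)
  have "?u \<noteq> []"
    by (simp add: subsequence_def)
  from curling_number_attained[OF this] k obtain y z where
    z: "z \<noteq> []" and u: "?u = y @ z @ z @ z @ concat (replicate k z)"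
    by auto
  let ?i = "length y" and ?p = "length z"
  have s1: "square_at w ?i ?p"
    by (rule prefix_eq_append_powerE[OF u])
  have "?u = (y @ z) @ z @ z @ concat (replicate k z)"
    using u by simp
  from prefix_eq_append_powerE[OF this] have "square_at w (?i + ?p) ?p"
    by simp
  with s1 have "overlap_at w ?i ?p"
    using z by (auto simp: overlap_at_def square_at_def le_less dest: spec[of _ 0])
  with overlap_freeD[OF assms, of ?p ?i] z show False
    by simp
qed

lemma two_le_curling_transform_iff:
  "2 \<le> curling_transform w n \<longleftrightarrow> (\<exists>i p. 0 < p \<and> i + 2 * p = Suc n \<and> square_at w i p)"
proof
  let ?u = "w [0 \<rightarrow> Suc n]"
  assume "2 \<le> curling_transform w n"
  then obtain k where k: "curling_number ?u = k + 2"
    by (metis add.commute curling_transform_def le_Suc_ex)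
  have "?u \<noteq> []"
    by (simp add: subsequence_def)
  from curling_number_attained[OF this] k obtain y z where
    z: "z \<noteq> []" and u: "?u = y @ concat (replicate (k + 2) z)"
    by auto
  have u: "?u = (y @ concat (replicate k z)) @ z @ z @ []"
    using u unfolding replicate_add by (simp add: numeral_2_eq_2)
  let ?i = "length (y @ concat (replicate k z))"
  have "square_at w ?i (length z)"
    by (rule prefix_eq_append_powerE[OF u])
  moreover have "?i + 2 * length z = Suc n"
    using arg_cong[OF u, of length] by simp
  ultimately show "\<exists>i p. 0 < p \<and> i + 2 * p = Suc n \<and> square_at w i p"
    using z by blast
next
  assume "\<exists>i p. 0 < p \<and> i + 2 * p = Suc n \<and> square_at w i p"
  then obtain i p where p: "0 < p" "i + 2 * p = Suc n" and sq: "square_at w i p"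
    by blast
  let ?z = "w [i \<rightarrow> i + p]"
  have "Suc n = i + p + p"
    using p by simp
  then have "w [0 \<rightarrow> Suc n] = w [0 \<rightarrow> i] @ w [i \<rightarrow> i + p] @ w [i + p \<rightarrow> i + p + p]"
    by (simp only: subsequence_append append_assoc)
  also have "w [i + p \<rightarrow> i + p + p] = ?z"
    using sq by (auto intro!: nth_equalityI simp: square_at_def)
  finally have "w [0 \<rightarrow> Suc n] = w [0 \<rightarrow> i] @ concat (replicate 2 ?z)"
    by (simp add: numeral_2_eq_2)
  moreover have "?z \<noteq> []"
    using p by (simp add: subsequence_def)
  ultimately show "2 \<le> curling_transform w n"
    unfolding curling_transform_def by (intro curling_number_greatest) auto
qed

lemma curling_transform_overlap_free:
  assumes "overlap_free w"
  shows "curling_transform w n =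
    (if \<exists>i p. 0 < p \<and> i + 2 * p = Suc n \<and> square_at w i p then 2 else 1)"
proof -
  have "1 \<le> curling_transform w n"
    unfolding curling_transform_def
    by (rule curling_number_attained[THEN conjunct1]) (simp add: subsequence_def)
  then show ?thesis
    using curling_number_le_2[OF assms, of n] two_le_curling_transform_iff[of w n] by auto
qed

section \<open>The Thue--Morse word\<close>

fun thue_morse :: "bool word" where
  "thue_morse n = (if n = 0 then False
     else if even n then thue_morse (n div 2) else \<not> thue_morse (n div 2))"

declare thue_morse.simps [simp del]

lemma thue_morse_even [simp]: "thue_morse (2 * n) = thue_morse n"
  by (cases "n = 0") (auto simp: thue_morse.simps[of "2 * n"])

lemma thue_morse_odd [simp]: "thue_morse (Suc (2 * n)) = (\<not> thue_morse n)"
  by (subst thue_morse.simps) auto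

lemma thue_morse_even_add: "thue_morse (2 * a + 2 * b) = thue_morse (a + b)"
  using thue_morse_even[of "a + b"] by simp

lemma thue_morse_odd_add: "thue_morse (Suc (2 * a + 2 * b)) = (\<not> thue_morse (a + b))"
  using thue_morse_odd[of "a + b"] by simp

lemma thue_morse_Suc_even: "even n \<Longrightarrow> thue_morse (Suc n) = (\<not> thue_morse n)"
  by (auto elim!: evenE)

text \<open>One of the positions n and n + 1 is even, and the letter there differs from the next
  one.\<close>

lemma thue_morse_no_cube: "\<not> (thue_morse n = thue_morse (n + 1) \<and> thue_morse (n + 1) = thue_morse (n + 2))"
  using thue_morse_Suc_even[of n] thue_morse_Suc_even[of "Suc n"] by auto

text \<open>In an alternating stretch all letters at even positions agree. Three consecutive ones,
  at 2c, 2c + 2 and 2c + 4, are the letters at c, c + 1 and c + 2, which would be a cube.\<close>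

lemma thue_morse_not_alternating:
  assumes "\<And>j. j \<le> 5 \<Longrightarrow> thue_morse (n + j + 1) = (\<not> thue_morse (n + j))"
  shows False
proof -
  obtain c e where n: "n + e = 2 * c" and e: "e \<le> 1"
    using that[of 0 "n div 2"] that[of 1 "Suc n div 2"] by (cases "even n") auto
  have alt: "thue_morse (2 * c + j + 2) = thue_morse (2 * c + j)" if "j \<le> 2" for j
    using assms[of "e + j"] assms[of "e + j + 1"] n e that
    by (simp add: add.assoc[symmetric])
  have "thue_morse (2 * (c + 1)) = thue_morse (2 * c)" "thue_morse (2 * (c + 2)) = thue_morse (2 * (c + 1))"
    using alt[of 0] alt[of 2] by (simp_all add: algebra_simps)
  then show False
    using thue_morse_no_cube[of c] by (simp only: thue_morse_even) simp
qed

text \<open>Strong induction on the period. An even period can be halved, period 1 is a cube of a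
  letter, and an odd period of at least 3 forces seven alternating letters.\<close>

lemma thue_morse_not_overlap_at: "0 < p \<Longrightarrow> \<not> overlap_at thue_morse i p"
proof (induction p arbitrary: i rule: less_induct)
  case (less p)
  show ?case
  proof
    assume ov: "overlap_at thue_morse i p"
    have per: "thue_morse (i + p + j) = thue_morse (i + j)" if "j \<le> p" for j
      using ov that by (simp add: overlap_at_def)
    have "even p \<or> p = 1 \<or> odd p \<and> 3 \<le> p"
      using less.prems by presburger
    then consider "even p" | "p = 1" | "odd p" "3 \<le> p"
      by blast
    then show False
    proof cases
      case 1
      then obtain p' where p': "p = 2 * p'"
        by (elim evenE)
      \<comment> \<open>Every second letter of the overlap, starting with the first, is a letter of
        the word at half the position, or its negation if i is odd.\<close>
      have "overlap_at thue_morse (i div 2) p'"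
        unfolding overlap_at_def
      proof (intro allI impI)
        fix j assume "j \<le> p'"
        then have *: "thue_morse (i + 2 * p' + 2 * j) = thue_morse (i + 2 * j)"
          using per[of "2 * j"] unfolding p' by simp
        show "thue_morse (i div 2 + j) = thue_morse (i div 2 + p' + j)"
        proof (cases "even i")
          case True
          then obtain a where "i = 2 * a" by (elim evenE)
          then show ?thesis
            using * thue_morse_even_add[of "a + p'" j] thue_morse_even_add[of a j]
            by (simp add: add.assoc)
        next
          case False
          then obtain a where "i = Suc (2 * a)" by (auto elim: oddE)
          then show ?thesis
            using * thue_morse_odd_add[of "a + p'" j] thue_morse_odd_add[of a j]
            by (simp add: add.assoc)
        qed
      qed
      with less.IH[of p' "i div 2"] less.prems p' show False
        by simp
    next
      case 2
      with per[of 0] per[of 1] thue_morse_no_cube[of i] show False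
        by (simp add: numeral_2_eq_2)
    next
      case 3
      text \<open>An odd period moves every pair of neighbours to the other parity, and one of the two
        copies is an image of a single letter, so all neighbours in the overlap differ.\<close>
      have alt: "thue_morse (Suc m) = (\<not> thue_morse m)" if m: "i \<le> m" "m < i + p" for m
      proof -
        obtain j where j: "m = i + j" "j < p"
          using m le_Suc_ex[of i m] by auto
        have "even m \<or> even (m + p)"
          using 3 by auto
        then show ?thesis
          using thue_morse_Suc_even[of m] thue_morse_Suc_even[of "m + p"] per[of j] per[of "Suc j"] j
          by (auto simp: ac_simps)
      qed
      have "thue_morse (i + j + 1) = (\<not> thue_morse (i + j))" if "j \<le> 5" for j
      proof (cases "j < p")
        case True
        then show ?thesis using alt[of "i + j"] by simp
      next
        case False
        then obtain l where l: "j = p + l" using le_Suc_ex[of p j] by auto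
        with that 3 have "l < p" by simp
        then show ?thesis
          using alt[of "i + l"] per[of l] per[of "Suc l"] l by (simp add: ac_simps)
      qed
      then show False
        by (rule thue_morse_not_alternating)
    qed
  qed
qed

lemma overlap_free_thue_morse: "overlap_free thue_morse"
  by (intro overlap_freeI thue_morse_not_overlap_at)

section \<open>Short factors of the Thue--Morse word\<close>

fun tm_image :: "bool list \<Rightarrow> bool list" where
  "tm_image [] = []"
| "tm_image (a # x) = a # (\<not> a) # tm_image x"

definition tm_extend :: "nat \<Rightarrow> bool list list \<Rightarrow> bool list list" where
  "tm_extend l xs = remdups
     (concat (map (\<lambda>x. let y = tm_image x in [take l y, take l (tl y)]) xs))"

lemma set_tm_extend:
  "set (tm_extend l xs) = (\<Union>x\<in>set xs. {take l (tm_image x), take l (tl (tm_image x))})"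
  by (simp add: tm_extend_def Let_def)

lemma length_tm_image: "length (tm_image x) = 2 * length x"
  by (induction x) auto

lemma nth_tm_image:
  "k < length x \<Longrightarrow> tm_image x ! (2 * k) = x ! k \<and>
    tm_image x ! Suc (2 * k) = (\<not> x ! k)"
  by (induction x arbitrary: k) (auto simp: nth_Cons' less_Suc_eq_0_disj)

lemma tm_image_subsequence:
  "tm_image (thue_morse [q \<rightarrow> q + l]) = thue_morse [2 * q \<rightarrow> 2 * (q + l)]"
proof (rule nth_equalityI)
  fix k assume k: "k < length (tm_image (thue_morse [q \<rightarrow> q + l]))"
  then have kl: "k < 2 * l"
    by (simp only: length_tm_image) simp
  show "tm_image (thue_morse [q \<rightarrow> q + l]) ! k = (thue_morse [2 * q \<rightarrow> 2 * (q + l)]) ! k"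
  proof (cases "even k")
    case True
    then obtain c where "k = 2 * c" by (elim evenE)
    then show ?thesis
      using kl nth_tm_image[of c "thue_morse [q \<rightarrow> q + l]"] thue_morse_even_add[of q c] by simp
  next
    case False
    then obtain c where "k = Suc (2 * c)" by (auto elim: oddE)
    then show ?thesis
      using kl nth_tm_image[of c "thue_morse [q \<rightarrow> q + l]"] thue_morse_odd_add[of q c] by simp
  qed
qed (simp add: length_tm_image)

text \<open>The word is fixed by the morphism 0 -> 01, 1 -> 10, which is \<open>tm_image\<close>. So
  the factor at n is cut from the image of the factor at \<open>n div 2\<close>, at offset 0 or 1 by
  the parity of n; the strict bound leaves room for offset 1.\<close>

lemma subsequence_in_tm_extend:
  assumes "\<And>q. thue_morse [q \<rightarrow> q + l] \<in> set xs" "l' < 2 * l"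
  shows "thue_morse [n \<rightarrow> n + l'] \<in> set (tm_extend l' xs)"
proof -
  define q where "q = n div 2"
  define y where "y = thue_morse [2 * q \<rightarrow> 2 * (q + l)]"
  have "thue_morse [n \<rightarrow> n + l'] = (if even n then take l' y else take l' (tl y))"
  proof (rule nth_equalityI)
    show "length (thue_morse [n \<rightarrow> n + l']) = length (if even n then take l' y else take l' (tl y))"
      using assms(2) by (simp add: y_def)
    fix k assume "k < length (thue_morse [n \<rightarrow> n + l'])"
    moreover have "n = 2 * q \<or> odd n \<and> n = Suc (2 * q)"
      by (auto simp: q_def)
    ultimately show "(thue_morse [n \<rightarrow> n + l']) ! k
        = (if even n then take l' y else take l' (tl y)) ! k"
      using assms(2) by (auto simp: y_def nth_tl)
  qed
  moreover have "y = tm_image (thue_morse [q \<rightarrow> q + l])"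
    by (simp only: y_def tm_image_subsequence)
  ultimately have "thue_morse [n \<rightarrow> n + l'] \<in>
      {take l' (tm_image (thue_morse [q \<rightarrow> q + l])), take l' (tl (tm_image (thue_morse [q \<rightarrow> q + l])))}"
    by (metis insert_iff)
  then show ?thesis
    unfolding set_tm_extend by (rule UN_I[OF assms(1)])
qed

text \<open>The chain of lengths 2, 3, 5, 8 respects the bound \<open>l' < 2 * l\<close>. Lengths 5
  and 8 are what \<open>encode 2\<close> and \<open>encode 5\<close> read.\<close>

definition tm_factors3 :: "bool list list" where
  "tm_factors3 = tm_extend 3 [[False, False], [False, True], [True, False], [True, True]]"

definition tm_factors5 :: "bool list list" where
  "tm_factors5 = tm_extend 5 tm_factors3"

definition tm_factors8 :: "bool list list" where
  "tm_factors8 = tm_extend 8 tm_factors5"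

lemma thue_morse_factor5: "thue_morse [n \<rightarrow> n + 5] \<in> set tm_factors5"
  and thue_morse_factor8: "thue_morse [n \<rightarrow> n + 8] \<in> set tm_factors8"
proof -
  have "thue_morse [n \<rightarrow> n + 2] \<in> set [[False, False], [False, True], [True, False], [True, True]]" for n
    by (auto simp: subsequence_def)
  then have "thue_morse [n \<rightarrow> n + 3] \<in> set tm_factors3" for n
    unfolding tm_factors3_def by (rule subsequence_in_tm_extend) simp
  then have 5: "thue_morse [n \<rightarrow> n + 5] \<in> set tm_factors5" for n
    unfolding tm_factors5_def by (rule subsequence_in_tm_extend) simp
  then show "thue_morse [n \<rightarrow> n + 5] \<in> set tm_factors5" .
  show "thue_morse [n \<rightarrow> n + 8] \<in> set tm_factors8"
    unfolding tm_factors8_def by (rule subsequence_in_tm_extend[OF 5]) simp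
qed

section \<open>The block code\<close>

text \<open>The keys are the ten factors of length 4 of the Thue--Morse word; on other words the
  value is unspecified.\<close>

definition block :: "bool list \<Rightarrow> nat list" where
  "block x = the (map_of
    [([False, False, True, False], [0, 1, 0, 2, 2, 1, 2, 2]),
     ([False, False, True, True], [0, 1, 0, 2, 2, 3, 2, 2]),
     ([False, True, False, False], [0, 2, 3, 3, 0, 2, 2, 1]),
     ([False, True, False, True], [1, 3, 2, 2, 1, 3, 3, 0]),
     ([False, True, True, False], [3, 0, 2, 2, 3, 0, 0, 3]),
     ([True, False, False, True], [2, 1, 1, 2, 1, 0, 1, 1]),
     ([True, False, True, False], [1, 2, 2, 3, 3, 0, 3, 3]),
     ([True, False, True, True], [3, 0, 0, 2, 2, 3, 2, 2]),
     ([True, True, False, False], [3, 2, 0, 0, 3, 3, 2, 1]),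
     ([True, True, False, True], [3, 1, 0, 0, 3, 3, 1, 2])] x)"

definition encode :: "nat \<Rightarrow> bool list \<Rightarrow> nat list" where
  "encode l x = concat (map (\<lambda>j. block (take 4 (drop j x))) [0..<l])"

definition code_word :: "nat word" where
  "code_word m = block (thue_morse [m div 8 \<rightarrow> m div 8 + 4]) ! (m mod 8)"

lemma subsequence_append_subsequence:
  "i \<le> j \<Longrightarrow> w [i \<rightarrow> j] @ w [j \<rightarrow> j + d] = w [i \<rightarrow> j + d]"
  unfolding subsequence_def map_append[symmetric] by (subst upt_add_eq_append[of i j d]) simp_all

definition blocks_wf :: bool where
  "blocks_wf \<longleftrightarrow> list_all (\<lambda>x. let u = block (take 4 x) in
     length u = 8 \<and> list_all (\<lambda>a. a \<in> set [0, 1, 2, 3]) u) tm_factors5"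

lemma blocks_wf: blocks_wf
  by code_simp

lemma
  shows length_block: "length (block (thue_morse [q \<rightarrow> q + 4])) = 8"
    and set_block: "set (block (thue_morse [q \<rightarrow> q + 4])) \<subseteq> {0, 1, 2, 3}"
  using blocks_wf thue_morse_factor5[of q]
  by (auto simp: blocks_wf_def Let_def list_all_iff dest!: bspec)

lemma block_eq_code_word: "block (thue_morse [q \<rightarrow> q + 4]) = code_word [8 * q \<rightarrow> 8 * q + 8]"
  by (rule nth_equalityI) (simp_all add: length_block code_word_def)

lemma range_code_word: "range code_word \<subseteq> {0, 1, 2, 3}"
proof -
  have "code_word m \<in> set (block (thue_morse [m div 8 \<rightarrow> m div 8 + 4]))" for m
    unfolding code_word_def by (rule nth_mem) (simp add: length_block)
  then show ?thesis
    using set_block by (meson image_subsetI subsetD)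
qed

text \<open>This turns finite checks on \<open>encode\<close> into facts about
  \<open>code_word\<close>. The last of l blocks looks three letters past its own, hence
  \<open>l + 3\<close>.\<close>

lemma encode_thue_morse:
  "l + 3 \<le> n \<Longrightarrow> encode l (thue_morse [q \<rightarrow> q + n]) = code_word [8 * q \<rightarrow> 8 * (q + l)]"
proof (induction l)
  case 0
  then show ?case by (simp add: encode_def)
next
  case (Suc l)
  have "encode (Suc l) (thue_morse [q \<rightarrow> q + n])
      = encode l (thue_morse [q \<rightarrow> q + n]) @ block (thue_morse [q + l \<rightarrow> q + l + 4])"
    using Suc.prems by (simp add: encode_def min_def)
  also have "\<dots> = code_word [8 * q \<rightarrow> 8 * (q + l)] @ code_word [8 * (q + l) \<rightarrow> 8 * (q + l) + 8]"
    using Suc by (simp only: block_eq_code_word)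
  also have "\<dots> = code_word [8 * q \<rightarrow> 8 * (q + l) + 8]"
    by (rule subsequence_append_subsequence) auto
  finally show ?case
    by (simp add: algebra_simps)
qed

section \<open>Synchronisation and long squares\<close>

text \<open>Eight consecutive letters lie within two adjacent blocks. The check says that they can
  equal a block only when aligned, and that a block determines the four letters it encodes.\<close>

definition blocks_sync :: bool where
  "blocks_sync \<longleftrightarrow> list_all (\<lambda>x. list_all (\<lambda>y. list_all (\<lambda>e.
     take 8 (drop e (encode 2 y)) = block (take 4 x) \<longrightarrow> e = 0 \<and> take 4 y = take 4 x)
     [0..<8]) tm_factors5) tm_factors5"

lemma blocks_sync: blocks_sync
  by code_simp

lemma code_word_sync:
  assumes "\<And>j. j < 8 \<Longrightarrow> code_word (8 * a + j) = code_word (8 * a + p + j)"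
  shows "8 dvd p"
    and "j < 4 \<Longrightarrow> thue_morse (a + j) = thue_morse (a + p div 8 + j)"
proof -
  define q e where "q = a + p div 8" and "e = p mod 8"
  have e: "e < 8" and ap: "8 * a + p = 8 * q + e"
    by (simp_all add: q_def e_def)
  let ?x = "thue_morse [a \<rightarrow> a + 5]" and ?y = "thue_morse [q \<rightarrow> q + 5]"
  have "take 8 (drop e (encode 2 ?y)) = code_word [8 * a + p \<rightarrow> 8 * a + p + 8]"
    using e by (subst encode_thue_morse) (simp_all add: ap)
  also have "\<dots> = code_word [8 * a \<rightarrow> 8 * a + 8]"
    using assms by (intro nth_equalityI) simp_all
  also have "\<dots> = block (take 4 ?x)"
    by (simp flip: block_eq_code_word)
  finally have "take 8 (drop e (encode 2 ?y)) = block (take 4 ?x)" .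
  then have "e = 0 \<and> take 4 ?y = take 4 ?x"
    using bspec[OF bspec[OF bspec[OF blocks_sync[unfolded blocks_sync_def list_all_iff]
      thue_morse_factor5[of a]] thue_morse_factor5[of q]], of e] e by simp
  then have "e = 0" and eq: "take 4 ?y = take 4 ?x"
    by simp_all
  then show "8 dvd p"
    by (simp add: e_def dvd_eq_mod_eq_0)
  show "thue_morse (a + j) = thue_morse (a + p div 8 + j)" if "j < 4"
    using arg_cong[OF eq, of "\<lambda>u. u ! j"] that by (simp add: q_def)
qed

lemma code_word_no_long_square:
  assumes "16 \<le> p"
  shows "\<not> square_at code_word i p"
proof
  assume "square_at code_word i p"
  then have per: "code_word k = code_word (k + p)" if "i \<le> k" "k < i + p" for k
    using that by (auto simp: square_at_def ac_simps dest!: le_Suc_ex)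
  \<comment> \<open>\<open>8 * a\<close> is the first block boundary from i on. That block ends by i
    + 15, hence within the first half.\<close>
  define a where "a = (i + 7) div 8"
  have a: "i \<le> 8 * a" "8 * a \<le> i + 7"
    unfolding a_def by presburger+
  have block: "code_word (8 * b + j) = code_word (8 * b + p + j)"
    if "i \<le> 8 * b" "8 * b + 8 \<le> i + p" "j < 8" for b j
    using per[of "8 * b + j"] that by (simp add: ac_simps)
  have "8 dvd p"
    using code_word_sync(1)[of a p] block[of a] a assms by simp
  then obtain m where m: "p = 8 * m" ..
  have "thue_morse (a + l) = thue_morse (a + m + l)" if "l \<le> m" for l
  proof -
    \<comment> \<open>Blocks a to a + m - 2 surely lie in the first half. The last of them still
      determines the letters up to a + m + 1, so l = m is reached, which makes the square an
      overlap.\<close>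
    define c where "c = min l (m - 2)"
    have c: "c \<le> l" "l - c < 4" "c + 2 \<le> m"
      using that assms m by (auto simp: c_def)
    with a m have "i \<le> 8 * (a + c)" "8 * (a + c) + 8 \<le> i + p"
      by simp_all
    then have "thue_morse (a + c + (l - c)) = thue_morse (a + c + p div 8 + (l - c))"
      using c by (intro code_word_sync(2) block)
    then show ?thesis
      using c m by (simp add: ac_simps)
  qed
  then have "overlap_at thue_morse a m"
    by (simp add: overlap_at_def)
  with thue_morse_not_overlap_at[of m a] assms m show False
    by simp
qed

section \<open>Squares of period below 16\<close>

text \<open>Here \<open>v\<close> lists the letters backwards from offset \<open>r\<close> of the last of five consecutive
  blocks, so squares ending there are prefixes of \<open>v\<close>, and \<open>b\<close> is the letter of \<open>t\<close> eight places
  after that position.\<close>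

definition short_squares :: bool where
  "short_squares \<longleftrightarrow> list_all (\<lambda>x. list_all (\<lambda>r.
     let v = rev (take (33 + r) (encode 5 x)); b = (x ! 5 \<noteq> (r \<in> set [1, 2, 4, 7])) in
     list_all (\<lambda>p. take p v = take p (drop p v) \<longrightarrow> b \<and> v ! p \<noteq> v ! (2 * p)) [1..<16] \<and>
     (b \<longrightarrow> list_ex (\<lambda>p. take p v = take p (drop p v)) [1..<6]))
     [0..<8]) tm_factors8"

lemma short_squares: short_squares
  by code_simp

text \<open>The letter at n is the parity of the binary digit sum of n, and 1, 2, 4, 7 are the
  numbers below 8 with odd digit sum.\<close>

lemma thue_morse_8:
  assumes "r < 8"
  shows "thue_morse (8 * q + r) \<longleftrightarrow> thue_morse q \<noteq> (r \<in> set [1, 2, 4, 7])"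
proof -
  have bit: "thue_morse (2 * n + of_bool b) \<longleftrightarrow> thue_morse n \<noteq> b" for n b
    by (cases b) auto
  have "r \<in> {0, 1, 2, 3, 4, 5, 6, 7}"
    using assms by auto
  then have r: "r = 2 * (2 * of_bool (odd (r div 4)) + of_bool (odd (r div 2))) + of_bool (odd r)"
    by auto
  then obtain a b c where r: "r = 2 * (2 * of_bool a + of_bool b) + of_bool c"
    by blast
  have "8 * q + r = 2 * (2 * (2 * q + of_bool a) + of_bool b) + of_bool c"
    by (simp add: r)
  then have "thue_morse (8 * q + r) \<longleftrightarrow> ((thue_morse q \<noteq> a) \<noteq> b) \<noteq> c"
    by (simp only: bit)
  then show ?thesis
    unfolding r by (cases a; cases b; cases c) simp_all
qed

text \<open>The bound 32 provides four whole blocks before the one containing m. Position m - 2p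
  directly precedes the square, so the inequality in the first part says that the square does not
  extend to the left to an overlap.\<close>

lemma code_word_square_at:
  assumes "32 \<le> m"
  shows "\<And>p. 0 < p \<Longrightarrow> p < 16 \<Longrightarrow> square_at code_word (m + 1 - 2 * p) p \<Longrightarrow>
      thue_morse (m + 8) \<and> code_word (m - p) \<noteq> code_word (m - 2 * p)"
    and "thue_morse (m + 8) \<Longrightarrow> \<exists>p. 0 < p \<and> p < 6 \<and> square_at code_word (m + 1 - 2 * p) p"
proof -
  define q r where "q = m div 8 - 4" and "r = m mod 8"
  have r: "r < 8" and m: "m = 8 * (q + 4) + r"
    using assms by (simp_all add: q_def r_def)
  define x where "x = thue_morse [q \<rightarrow> q + 8]"
  define v where "v = rev (take (33 + r) (encode 5 x))"
  define b where "b \<longleftrightarrow> x ! 5 \<noteq> (r \<in> set [1, 2, 4, 7])"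
  have x: "x \<in> set tm_factors8"
    unfolding x_def by (rule thue_morse_factor8)
  have v: "v = rev (code_word [8 * q \<rightarrow> Suc m])"
    unfolding v_def x_def using r by (subst encode_thue_morse) (simp_all add: m min_def ac_simps)
  \<comment> \<open>\<open>v\<close> has 33 + r letters, and the check reads indices up to 2p, which
    is at most 30.\<close>
  have nth: "v ! k = code_word (m - k)" if "k \<le> 32" for k
    using that by (simp add: v rev_nth m ac_simps)
  have sq: "take p v = take p (drop p v) \<longleftrightarrow> square_at code_word (m + 1 - 2 * p) p" if "p < 16" for p
  proof -
    have pm: "2 * p \<le> m"
      using that assms by linarith
    have len: "2 * p \<le> length v"
      using that by (simp add: v m)
    have "take p v = take p (drop p v) \<longleftrightarrow> (\<forall>k<p. v ! k = v ! (p + k))"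
      using len by (simp add: list_eq_iff_nth_eq)
    also have "\<dots> \<longleftrightarrow> (\<forall>k<p. code_word (m - k) = code_word (m - (p + k)))"
      using that nth by simp
    also have "\<dots> \<longleftrightarrow> square_at code_word (m + 1 - 2 * p) p"
      unfolding square_at_def
    proof safe
      fix j assume *: "\<forall>k<p. code_word (m - k) = code_word (m - (p + k))" and j: "j < p"
      \<comment> \<open>As \<open>v\<close> runs backwards, offset j in a half of the square becomes
        p - 1 - j.\<close>
      have eq: "m - (p - 1 - j) = m + 1 - 2 * p + p + j" "m - (p + (p - 1 - j)) = m + 1 - 2 * p + j"
        using j pm by linarith+
      have "p - 1 - j < p"
        using j by linarith
      with * show "code_word (m + 1 - 2 * p + j) = code_word (m + 1 - 2 * p + p + j)"
        by (metis eq)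
    next
      fix k assume *: "\<forall>j<p. code_word (m + 1 - 2 * p + j) = code_word (m + 1 - 2 * p + p + j)"
        and k: "k < p"
      have eq: "m - k = m + 1 - 2 * p + p + (p - 1 - k)" "m - (p + k) = m + 1 - 2 * p + (p - 1 - k)"
        using k pm by linarith+
      have "p - 1 - k < p"
        using k by linarith
      with * show "code_word (m - k) = code_word (m - (p + k))"
        by (metis eq)
    qed
    finally show ?thesis .
  qed
  \<comment> \<open>Since m + 8 = 8 (q + 5) + r, the relevant letter of \<open>x\<close> is
    \<open>x ! 5\<close>.\<close>
  have b: "b \<longleftrightarrow> thue_morse (m + 8)"
    using thue_morse_8[OF r, of "q + 5"] by (simp add: b_def x_def m ac_simps)
  have r': "r \<in> set [0..<8]"
    using r by simp
  have chk: "(\<forall>p\<in>{1..<16}. take p v = take p (drop p v) \<longrightarrow> b \<and> v ! p \<noteq> v ! (2 * p)) \<and>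
      (b \<longrightarrow> (\<exists>p\<in>{1..<6}. take p v = take p (drop p v)))"
    using bspec[OF bspec[OF short_squares[unfolded short_squares_def list_all_iff] x] r']
    by (simp only: Let_def list_ex_iff set_upt v_def b_def)
  show "thue_morse (m + 8) \<and> code_word (m - p) \<noteq> code_word (m - 2 * p)"
    if "0 < p" "p < 16" "square_at code_word (m + 1 - 2 * p) p" for p
  proof -
    have "p \<in> {1..<16}" "take p v = take p (drop p v)"
      using that sq[of p] by simp_all
    then have "b \<and> v ! p \<noteq> v ! (2 * p)"
      using chk by blast
    then show ?thesis
      using that b nth[of p] nth[of "2 * p"] by simp
  qed
  show "\<exists>p. 0 < p \<and> p < 6 \<and> square_at code_word (m + 1 - 2 * p) p" if t: "thue_morse (m + 8)"
  proof -
    obtain p where "p \<in> {1..<6}" "take p v = take p (drop p v)"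
      using chk t b by blast
    then show ?thesis
      using sq[of p] by (intro exI[of _ p]) simp
  qed
qed

section \<open>The suffix starting at position 43\<close>

text \<open>Near the start of a suffix of the code word, the required squares must not begin too early.
  The suffix starting at position 43 meets this condition.\<close>

definition initial_squares :: bool where
  "initial_squares \<longleftrightarrow> list_all (\<lambda>n. thue_morse (n + 51) \<longrightarrow> list_ex (\<lambda>p. 2 * p \<le> n + 1 \<and>
     list_all (\<lambda>j. code_word (n + 44 - 2 * p + j) = code_word (n + 44 - 2 * p + p + j)) [0..<p])
     [1..<6]) [0..<11]"

lemma initial_squares: initial_squares
  by code_simp

text \<open>Dropping the first letter of an overlap leaves a square that extends to the left with
  the same period. Long squares do not exist, and short ones do not extend.\<close>

lemma overlap_free_suffix_code_word: "overlap_free (suffix 43 code_word)"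
proof (rule overlap_freeI)
  fix i p :: nat assume p: "0 < p"
  show "\<not> overlap_at (suffix 43 code_word) i p"
  proof
    assume "overlap_at (suffix 43 code_word) i p"
    then have ov: "overlap_at code_word (43 + i) p"
      by (simp add: overlap_at_def add.assoc)
    with overlap_at_imp_square_at code_word_no_long_square have p16: "p < 16"
      by (meson not_le)
    have per: "code_word (43 + i + j) = code_word (43 + i + p + j)" if "j \<le> p" for j
      using ov that by (simp add: overlap_at_def)
    \<comment> \<open>The last position of the overlap; it exceeds 32 because the suffix starts at
      43.\<close>
    define m where "m = 43 + i + 2 * p"
    have m: "m + 1 - 2 * p = Suc (43 + i)" "m - p = 43 + i + p" "m - 2 * p = 43 + i"
      by (simp_all add: m_def)
    have "square_at code_word (Suc (43 + i)) p"
      unfolding square_at_def using per[of "Suc j" for j] by (simp add: ac_simps)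
    then have "square_at code_word (m + 1 - 2 * p) p"
      by (simp only: m)
    then have "code_word (m - p) \<noteq> code_word (m - 2 * p)"
      using code_word_square_at(1)[of m p] p p16 by (simp add: m_def)
    with per[of 0] show False
      by (simp add: m)
  qed
qed

text \<open>By overlap-freeness the value is 2 exactly where a square ends. Position n of the suffix
  is m = n + 43 in \<open>code_word\<close>, and the letter at m + 8 decides, hence 51.\<close>

lemma curling_transform_suffix_code_word:
  "curling_transform (suffix 43 code_word) n = (if thue_morse (n + 51) then 2 else 1)"
proof -
  have shift: "square_at (suffix 43 code_word) i p \<longleftrightarrow> square_at code_word (i + 43) p" for i p
    by (simp add: square_at_def ac_simps)
  have "(\<exists>i p. 0 < p \<and> i + 2 * p = Suc n \<and> square_at code_word (i + 43) p) \<longleftrightarrow> thue_morse (n + 51)"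
  proof
    assume "\<exists>i p. 0 < p \<and> i + 2 * p = Suc n \<and> square_at code_word (i + 43) p"
    then obtain i p where p: "0 < p" "i + 2 * p = Suc n" and sq: "square_at code_word (i + 43) p"
      by blast
    have "p < 16"
      using sq code_word_no_long_square by (meson not_le)
    moreover have "i + 43 = n + 43 + 1 - 2 * p"
      using p by simp
    ultimately have "thue_morse (n + 43 + 8)"
      using code_word_square_at(1)[of "n + 43" p] p(1) sq by simp
    then show "thue_morse (n + 51)"
      by (simp add: add.assoc)
  next
    assume t: "thue_morse (n + 51)"
    obtain p where p: "0 < p" "2 * p \<le> n + 1" and sq: "square_at code_word (n + 44 - 2 * p) p"
    proof (cases "n < 11")
      case True
      then have "n \<in> set [0..<11]"
        by simp
      from bspec[OF initial_squares[unfolded initial_squares_def list_all_iff] this] t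
      obtain p where "p \<in> set [1..<6]" "2 * p \<le> n + 1"
        "\<forall>j\<in>set [0..<p]. code_word (n + 44 - 2 * p + j) = code_word (n + 44 - 2 * p + p + j)"
        unfolding list_ex_iff by blast
      then show ?thesis
        by (intro that[of p]) (simp_all add: square_at_def)
    next
      \<comment> \<open>The period is at most 5, so the square has at most 10 letters and starts
        inside the suffix.\<close>
      case False
      from t have "thue_morse (n + 43 + 8)"
        by (simp add: add.assoc)
      with code_word_square_at(2)[of "n + 43"] obtain p where
        p: "0 < p" "p < 6" and "square_at code_word (n + 43 + 1 - 2 * p) p"
        by auto
      moreover have "n + 43 + 1 - 2 * p = n + 44 - 2 * p"
        by simp
      ultimately have "square_at code_word (n + 44 - 2 * p) p"
        by (simp only:)
      moreover have "2 * p \<le> n + 1"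
        using p False by linarith
      ultimately show ?thesis
        using p(1) by (intro that)
    qed
    have "n + 1 - 2 * p + 2 * p = Suc n" "n + 44 - 2 * p = n + 1 - 2 * p + 43"
      using p by linarith+
    with p(1) sq show "\<exists>i p. 0 < p \<and> i + 2 * p = Suc n \<and> square_at code_word (i + 43) p"
      by (intro exI[of _ "n + 1 - 2 * p"] exI[of _ p]) (simp only:)
  qed
  then show ?thesis
    unfolding curling_transform_overlap_free[OF overlap_free_suffix_code_word] shift
    by (simp only:)
qed

theorem theorem12:
  shows "\<exists>w :: nat word. range w \<subseteq> {0, 1, 2, 3} \<and> overlap_free w \<and>
    overlap_free (curling_transform w)"
proof (intro exI conjI)
  show "range (suffix 43 code_word) \<subseteq> {0, 1, 2, 3}"
    using range_code_word unfolding suffix_def image_subset_iff by blast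
  show "overlap_free (suffix 43 code_word)"
    by (rule overlap_free_suffix_code_word)
  let ?f = "\<lambda>b. if b then 2 else 1 :: nat"
  have "curling_transform (suffix 43 code_word) = (\<lambda>n. ?f (thue_morse (n + 51)))"
    by (rule ext) (rule curling_transform_suffix_code_word)
  moreover have "inj ?f"
    by (auto simp: inj_def)
  ultimately show "overlap_free (curling_transform (suffix 43 code_word))"
    using overlap_free_inj_comp[OF overlap_free_thue_morse, of ?f 51] by (simp only:)
qed

end
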